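(* Let $\beta>1$. Suppose that $\lambda\in(0,1)$ is a real number such that $$\lambda-\lambda\ln\lambda<\frac{(\beta-1)^2}{\beta^3}\quad\text{and}\quad\lambda<\beta^{-1}.$$ Then for any $n\in\mathbb{N}$ with $n\ge-\log_\beta\lambda$, we have $\#\Xi_n(\beta)\ge\lambda\,\#\Sigma_n(\beta)$.
   Context: $\mathbb{N}=\{1,2,\dots\}$ and $\#$ denotes cardinality. For $\beta>1$ let $T_\beta(x)=\beta x-\lfloor\beta x\rfloor$ on $[0,1]$ and $\varepsilon_n(x,\beta)=\lfloor\beta T_\beta^{n-1}x\rfloor$ for $n\ge1$ (the digits of the beta-expansion of $x$). Let $\Sigma_n(\beta)=\{\varepsilon_1(x,\beta)\cdots\varepsilon_n(x,\beta)\colon x\in[0,1)\}$. For $w\in\Sigma_n(\beta)$ let $\mathfrak{I}(w)=\{x\in[0,1)\colon\varepsilon_1(x,\beta)\cdots\varepsilon_n(x,\beta)=w\}$, which is an interval of length $|\mathfrak{I}(w)|\le\beta^{-n}$. Let $\Xi_n(\beta)=\{w\in\Sigma_n(\beta)\colon|\mathfrak{I}(w)|=\beta^{-n}\}$ (the words of full cylinders of order $n$). *)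

theory Defs
  imports "HOL-Analysis.Analysis"
begin

definition beta_T :: "real \<Rightarrow> real \<Rightarrow> real" where
  "beta_T \<beta> x = \<beta> * x - of_int \<lfloor>\<beta> * x\<rfloor>"

(* Digits are indexed from n = 1; the value at n = 0 is irrelevant. *)
definition beta_digit :: "real \<Rightarrow> nat \<Rightarrow> real \<Rightarrow> int" where
  "beta_digit \<beta> n x = \<lfloor>\<beta> * (beta_T \<beta> ^^ (n - 1)) x\<rfloor>"

definition beta_word :: "real \<Rightarrow> nat \<Rightarrow> real \<Rightarrow> int list" where
  "beta_word \<beta> n x = map (\<lambda>i. beta_digit \<beta> i x) [1..<Suc n]"

definition beta_words :: "real \<Rightarrow> nat \<Rightarrow> int list set" where
  "beta_words \<beta> n = beta_word \<beta> n ` {0..<1}"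

(* The order of the cylinder is the length of the word w. *)
definition cylinder :: "real \<Rightarrow> int list \<Rightarrow> real set" where
  "cylinder \<beta> w = {x \<in> {0..<1}. beta_word \<beta> (length w) x = w}"

(* Cylinders are intervals, so their length is their Lebesgue measure. *)
definition full_words :: "real \<Rightarrow> nat \<Rightarrow> int list set" where
  "full_words \<beta> n =
    {w \<in> beta_words \<beta> n. measure lborel (cylinder \<beta> w) = 1 / \<beta> ^ n}"

(* Hence card (beta_words \<beta> n) is a genuine count. *)
lemma finite_beta_words:
  assumes "\<beta> > 1"
  shows "finite (beta_words \<beta> n)"
proof -
  have T: "(beta_T \<beta> ^^ k) x \<in> {0..<1}" if "x \<in> {0..<1}" for k x
    using that
  proof (induction k)
    case (Suc k)
    show ?case
      by (simp add: beta_T_def) linarith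
  qed simp
  have d: "beta_digit \<beta> i x \<in> {0..\<lfloor>\<beta>\<rfloor>}" if "x \<in> {0..<1}" for i x
  proof -
    let ?y = "(beta_T \<beta> ^^ (i - 1)) x"
    have y: "0 \<le> ?y" "?y \<le> 1"
      using T[OF that, of "i - 1"] by auto
    have "0 \<le> \<beta> * ?y" "\<beta> * ?y \<le> \<beta>"
      using y assms by (auto simp: mult_left_le)
    then show ?thesis
      by (auto simp: beta_digit_def intro: floor_mono)
  qed
  have "beta_words \<beta> n \<subseteq> {w. set w \<subseteq> {0..\<lfloor>\<beta>\<rfloor>} \<and> length w = n}"
    using d by (fastforce simp: beta_words_def beta_word_def)
  then show ?thesis
    using finite_lists_length_eq[of "{0..\<lfloor>\<beta>\<rfloor>}" n] finite_subset by auto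
qed

end

theory Submission
  imports Defs
begin

text \<open>
  Write \<open>F\<^sub>k\<close> for the number of full words and \<open>N\<^sub>k\<close> for the number of all words of
  length \<open>k\<close>, and \<open>\<lambda>\<close> for \<open>l\<close>. The \<open>k\<close>-th iterate of the map sends the cylinder of a word of length \<open>k\<close>
  affinely, with slope \<open>\<beta>\<^sup>k\<close>, onto an interval \<open>[0, t)\<close> with \<open>0 < t \<le> 1\<close>; the word is
  full iff \<open>t = 1\<close>. Appending a digit \<open>d\<close> is possible iff \<open>0 \<le> d < \<beta> t\<close>, and it replaces
  \<open>t\<close> by \<open>min 1 (\<beta> t - d)\<close>. Two combinatorial facts follow. First, appending the digit 0
  keeps a full word full, so \<open>F\<^sub>k\<close> is nondecreasing in \<open>k\<close>. Secondly, only the largest possible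
  digit can lead to a word that is not full, so the number of such words of length \<open>k + 1\<close>
  is at most \<open>N\<^sub>k\<close>; summing up, \<open>N\<^sub>n \<le> F\<^sub>0 + \<dots> + F\<^sub>n\<close>. Moreover the cylinders of
  order \<open>k\<close> partition the unit interval into pieces of length at most \<open>\<beta>\<^sup>-\<^sup>k\<close>, with equality for
  full words, so that \<open>F\<^sub>k \<le> \<beta>\<^sup>k \<le> N\<^sub>k\<close>.

  Suppose now that \<open>F\<^sub>n < \<lambda> N\<^sub>n\<close>. In the sum \<open>F\<^sub>0 + \<dots> + F\<^sub>n\<close> every term is below
  \<open>\<lambda> N\<^sub>n\<close> by monotonicity, while the early terms are much smaller because of
  \<open>F\<^sub>k \<le> \<beta>\<^sup>k\<close>. The two bounds cross near \<open>\<beta>\<^sup>k = \<lambda> \<beta>\<^sup>n\<close>, which happens at some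
  \<open>k \<ge> 0\<close> precisely because \<open>n \<ge> - log\<^sub>\<beta> \<lambda>\<close>. So only about \<open>- log\<^sub>\<beta> \<lambda>\<close> terms are
  counted with the bound \<open>\<lambda> N\<^sub>n\<close>, and the others form a geometric sum of size about
  \<open>\<lambda> \<beta>\<^sup>n \<beta> / (\<beta> - 1)\<close>, which is again comparable to \<open>\<lambda> N\<^sub>n\<close>. Altogether \<open>N\<^sub>n\<close> is
  bounded by a multiple of \<open>(\<lambda> - \<lambda> ln \<lambda>) N\<^sub>n\<close> plus \<open>\<lambda> N\<^sub>n\<close>, and the two smallness
  conditions on \<open>\<lambda>\<close> make the total factor smaller than 1.
\<close>

section \<open>Geometry of cylinders\<close>

lemma length_beta_word [simp]: "length (beta_word \<beta> n x) = n"
  by (simp add: beta_word_def)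

lemma beta_word_Suc:
  "beta_word \<beta> (Suc n) x = beta_word \<beta> n x @ [\<lfloor>\<beta> * (beta_T \<beta> ^^ n) x\<rfloor>]"
  by (simp add: beta_word_def beta_digit_def)

lemma beta_words_iff_cylinder:
  "w \<in> beta_words \<beta> n \<longleftrightarrow> length w = n \<and> cylinder \<beta> w \<noteq> {}"
  unfolding beta_words_def cylinder_def by (auto simp: image_iff Bex_def)

lemma cylinder_snoc:
  "cylinder \<beta> (w @ [d]) =
     {x \<in> cylinder \<beta> w. \<lfloor>\<beta> * (beta_T \<beta> ^^ length w) x\<rfloor> = d}"
  by (auto simp: cylinder_def beta_word_Suc)

text \<open>The iterate of order \<open>length w\<close> maps the cylinder of \<open>w\<close> affinely onto \<open>[0, t)\<close>, and
  \<open>a\<close> is the left end point of the cylinder. All of the later dynamics of the cylinder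
  depends on \<open>t\<close> only.\<close>

definition affine_onto :: "real \<Rightarrow> int list \<Rightarrow> real \<Rightarrow> real \<Rightarrow> bool" where
  "affine_onto \<beta> w a t \<longleftrightarrow>
     0 < t \<and> t \<le> 1 \<and> cylinder \<beta> w = {a..<a + t / \<beta> ^ length w} \<and>
     (\<forall>x \<in> cylinder \<beta> w. (beta_T \<beta> ^^ length w) x = \<beta> ^ length w * (x - a))"

lemma affine_onto_Nil: "affine_onto \<beta> [] 0 1"
  by (auto simp: affine_onto_def cylinder_def beta_word_def)

lemma affine_onto_measure:
  assumes "\<beta> > 1" and "affine_onto \<beta> w a t"
  shows "measure lborel (cylinder \<beta> w) = t / \<beta> ^ length w"
  using assms by (auto simp: affine_onto_def)

text \<open>One more step stretches \<open>[0, t)\<close> to \<open>[0, \<beta> t)\<close> and cuts the result at the integers.\<close>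

lemma affine_onto_snoc:
  assumes \<beta>: "\<beta> > 1" and w: "affine_onto \<beta> w a t" and d: "0 \<le> d" "of_int d < \<beta> * t"
  shows "affine_onto \<beta> (w @ [d]) (a + of_int d / \<beta> ^ Suc (length w)) (min 1 (\<beta> * t - of_int d))"
proof -
  let ?n = "length w"
  let ?a = "a + of_int d / \<beta> ^ Suc ?n" and ?t = "min 1 (\<beta> * t - of_int d)"
  have cyl: "cylinder \<beta> w = {a..<a + t / \<beta> ^ ?n}"
    and it: "\<And>x. x \<in> cylinder \<beta> w \<Longrightarrow> (beta_T \<beta> ^^ ?n) x = \<beta> ^ ?n * (x - a)"
    using w by (auto simp: affine_onto_def)
  have pos: "\<beta> ^ Suc ?n > 0" "\<beta> ^ ?n > 0" using \<beta> by auto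
  have below: "x < a + t / \<beta> ^ ?n \<longleftrightarrow> \<beta> ^ Suc ?n * (x - a) < \<beta> * t" for x
  proof -
    have "x < a + t / \<beta> ^ ?n \<longleftrightarrow> \<beta> ^ ?n * (x - a) < t"
      using pos_less_divide_eq[OF pos(2), of "x - a" t] by (auto simp: mult.commute)
    also have "\<dots> \<longleftrightarrow> \<beta> * (\<beta> ^ ?n * (x - a)) < \<beta> * t"
      using \<beta> by (subst mult_less_cancel_left_pos) auto
    finally show ?thesis by (simp add: mult.assoc)
  qed
  have eq: "cylinder \<beta> (w @ [d]) = {?a..<?a + ?t / \<beta> ^ Suc ?n}"
  proof (rule set_eqI)
    fix x
    let ?y = "\<beta> ^ Suc ?n * (x - a)"
    have "x \<in> cylinder \<beta> (w @ [d]) \<longleftrightarrow> x \<in> cylinder \<beta> w \<and> \<lfloor>?y\<rfloor> = d"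
      using it[of x] by (auto simp: cylinder_snoc mult.assoc)
    also have "\<dots> \<longleftrightarrow> a \<le> x \<and> ?y < \<beta> * t \<and> of_int d \<le> ?y \<and> ?y < of_int d + 1"
      using below[of x] by (auto simp: cyl floor_eq_iff)
    also have "\<dots> \<longleftrightarrow> of_int d \<le> ?y \<and> ?y < of_int d + ?t"
    proof -
      have "a \<le> x" if "of_int d \<le> ?y"
      proof -
        have "0 \<le> ?y" using that d(1) by linarith
        then show ?thesis using pos(1) by (simp add: zero_le_mult_iff)
      qed
      then show ?thesis by auto
    qed
    also have "\<dots> \<longleftrightarrow> x \<in> {?a..<?a + ?t / \<beta> ^ Suc ?n}"
    proof -
      have "of_int d \<le> ?y \<longleftrightarrow> ?a \<le> x"
        using pos_divide_le_eq[OF pos(1), of "of_int d" "x - a"]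
        by (simp add: mult.commute le_diff_eq add.commute del: power_Suc)
      moreover have "?y < of_int d + ?t \<longleftrightarrow> x < ?a + ?t / \<beta> ^ Suc ?n"
        unfolding add.assoc add_divide_distrib[symmetric]
        using pos(1) pos_less_divide_eq[OF pos(1), of "x - a" "of_int d + ?t"]
        by (simp add: mult.commute less_diff_eq diff_less_eq add.commute del: power_Suc)
      ultimately show ?thesis by simp
    qed
    finally show "x \<in> cylinder \<beta> (w @ [d]) \<longleftrightarrow> x \<in> {?a..<?a + ?t / \<beta> ^ Suc ?n}" .
  qed
  have "(beta_T \<beta> ^^ Suc ?n) x = \<beta> ^ Suc ?n * (x - ?a)" if "x \<in> cylinder \<beta> (w @ [d])" for x
  proof -
    have "(beta_T \<beta> ^^ Suc ?n) x = \<beta> * (\<beta> ^ ?n * (x - a)) - of_int d"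
      using that it[of x] by (auto simp: cylinder_snoc beta_T_def)
    also have "\<dots> = \<beta> ^ Suc ?n * (x - ?a)"
      using \<beta> by (simp add: field_simps)
    finally show ?thesis .
  qed
  then show ?thesis
    using eq d by (auto simp: affine_onto_def simp del: power_Suc funpow.simps)
qed

lemma snoc_digit_bounds:
  assumes \<beta>: "\<beta> > 1" and w: "affine_onto \<beta> w a t" and ne: "cylinder \<beta> (w @ [d]) \<noteq> {}"
  shows "0 \<le> d" and "of_int d < \<beta> * t"
proof -
  obtain x where x: "x \<in> cylinder \<beta> w" and d: "d = \<lfloor>\<beta> * (beta_T \<beta> ^^ length w) x\<rfloor>"
    using ne by (auto simp: cylinder_snoc)
  define y where "y = (beta_T \<beta> ^^ length w) x"
  have "y = \<beta> ^ length w * (x - a)" "a \<le> x" "x < a + t / \<beta> ^ length w"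
    using w x by (auto simp: affine_onto_def y_def)
  then have y: "0 \<le> y" "y < t"
    using \<beta> pos_less_divide_eq[of "\<beta> ^ length w" "x - a" t] by (auto simp: mult.commute)
  then have "0 \<le> \<beta> * y" "\<beta> * y < \<beta> * t" using \<beta> by auto
  then show "0 \<le> d" and "of_int d < \<beta> * t"
    unfolding d y_def[symmetric] by (auto intro: order.strict_trans1[OF of_int_floor_le])
qed

lemma affine_onto_exists:
  assumes "\<beta> > 1" and "cylinder \<beta> w \<noteq> {}"
  obtains a t where "affine_onto \<beta> w a t"
proof -
  have "\<exists>a t. affine_onto \<beta> w a t"
    using assms(2)
  proof (induction w rule: rev_induct)
    case Nil
    show ?case using affine_onto_Nil by blast
  next
    case (snoc d w)
    then have "cylinder \<beta> w \<noteq> {}" by (auto simp: cylinder_snoc)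
    then obtain a t where w: "affine_onto \<beta> w a t" using snoc.IH by blast
    show ?case
      using affine_onto_snoc[OF assms(1) w snoc_digit_bounds[OF assms(1) w snoc.prems]] by blast
  qed
  then show ?thesis using that by blast
qed

lemma full_iff_affine_onto_1:
  assumes "\<beta> > 1" and "affine_onto \<beta> w a t" and "length w = n"
  shows "w \<in> full_words \<beta> n \<longleftrightarrow> t = 1"
proof -
  have "cylinder \<beta> w \<noteq> {}"
    using assms(1,2) by (auto simp: affine_onto_def)
  then show ?thesis
    using assms affine_onto_measure[OF assms(1,2)]
    by (auto simp: full_words_def beta_words_iff_cylinder)
qed

section \<open>Counting words by length\<close>

text \<open>The cylinders of one order partition \<open>[0, 1)\<close>, so their lengths add up to 1.\<close>

lemma sum_measure_cylinder:
  assumes "\<beta> > 1"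
  shows "(\<Sum>w \<in> beta_words \<beta> n. measure lborel (cylinder \<beta> w)) = 1"
proof -
  have U: "(\<Union>w \<in> beta_words \<beta> n. cylinder \<beta> w) = {0..<1}"
    by (auto simp: beta_words_def cylinder_def)
  have "measure lborel (\<Union>w \<in> beta_words \<beta> n. cylinder \<beta> w) =
          (\<Sum>w \<in> beta_words \<beta> n. measure lborel (cylinder \<beta> w))"
  proof (rule measure_UNION')
    fix w assume "w \<in> beta_words \<beta> n"
    then obtain a t where "affine_onto \<beta> w a t"
      using affine_onto_exists[OF assms] unfolding beta_words_iff_cylinder by blast
    then show "cylinder \<beta> w \<in> fmeasurable lborel"
      using assms by (auto simp: affine_onto_def fmeasurable_def)
  next
    show "pairwise (\<lambda>v w. disjnt (cylinder \<beta> v) (cylinder \<beta> w)) (beta_words \<beta> n)"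
      by (auto simp: pairwise_def disjnt_def beta_words_iff_cylinder cylinder_def)
  qed (rule finite_beta_words[OF assms])
  then show ?thesis unfolding U by simp
qed

lemma card_beta_words_ge:
  assumes "\<beta> > 1"
  shows "\<beta> ^ n \<le> real (card (beta_words \<beta> n))"
proof -
  have "1 = (\<Sum>w \<in> beta_words \<beta> n. measure lborel (cylinder \<beta> w))"
    using sum_measure_cylinder[OF assms] by simp
  also have "\<dots> \<le> (\<Sum>w \<in> beta_words \<beta> n. 1 / \<beta> ^ n)"
  proof (rule sum_mono)
    fix w assume w: "w \<in> beta_words \<beta> n"
    then obtain a t where at: "affine_onto \<beta> w a t"
      using affine_onto_exists[OF assms] unfolding beta_words_iff_cylinder by blast
    then have "t \<le> 1" by (simp add: affine_onto_def)
    then show "measure lborel (cylinder \<beta> w) \<le> 1 / \<beta> ^ n"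
      using w affine_onto_measure[OF assms at] assms
      by (auto simp: beta_words_iff_cylinder divide_right_mono)
  qed
  finally show ?thesis using assms by (simp add: field_simps)
qed

lemma finite_full_words:
  "\<beta> > 1 \<Longrightarrow> finite (full_words \<beta> n)"
  by (rule finite_subset[OF _ finite_beta_words[of \<beta> n]]) (auto simp: full_words_def)

lemma card_full_words_le_power:
  assumes "\<beta> > 1"
  shows "real (card (full_words \<beta> n)) \<le> \<beta> ^ n"
proof -
  have "(\<Sum>w \<in> full_words \<beta> n. measure lborel (cylinder \<beta> w)) \<le>
          (\<Sum>w \<in> beta_words \<beta> n. measure lborel (cylinder \<beta> w))"
    by (rule sum_mono2[OF finite_beta_words[OF assms]]) (auto simp: full_words_def)
  then have "(\<Sum>w \<in> full_words \<beta> n. measure lborel (cylinder \<beta> w)) \<le> 1"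
    using sum_measure_cylinder[OF assms] by simp
  moreover have "(\<Sum>w \<in> full_words \<beta> n. measure lborel (cylinder \<beta> w)) =
                   real (card (full_words \<beta> n)) / \<beta> ^ n"
    by (simp add: full_words_def)
  ultimately show ?thesis using assms by (simp add: field_simps)
qed

text \<open>Appending the digit 0 to a full word gives a full word, because \<open>min 1 \<beta> = 1\<close>.\<close>

lemma card_full_words_Suc:
  assumes "\<beta> > 1"
  shows "card (full_words \<beta> n) \<le> card (full_words \<beta> (Suc n))"
proof (rule card_inj_on_le[where f = "\<lambda>w. w @ [0]"])
  show "(\<lambda>w. w @ [0]) ` full_words \<beta> n \<subseteq> full_words \<beta> (Suc n)"
  proof clarify
    fix w assume w: "w \<in> full_words \<beta> n"
    then have len: "length w = n" and "cylinder \<beta> w \<noteq> {}"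
      by (auto simp: full_words_def beta_words_iff_cylinder)
    then obtain a t where at: "affine_onto \<beta> w a t"
      using affine_onto_exists[OF assms] by blast
    with w len have "t = 1" using full_iff_affine_onto_1[OF assms] by blast
    then have "affine_onto \<beta> (w @ [0]) a 1"
      using affine_onto_snoc[OF assms at, of 0] assms by simp
    then show "w @ [0] \<in> full_words \<beta> (Suc n)"
      using full_iff_affine_onto_1[OF assms] len by simp
  qed
qed (auto simp: inj_on_def finite_full_words[OF assms])

lemma card_full_words_mono:
  assumes "\<beta> > 1" and "m \<le> n"
  shows "card (full_words \<beta> m) \<le> card (full_words \<beta> n)"
  by (rule lift_Suc_mono_le[where f = "\<lambda>k. card (full_words \<beta> k)"])
    (use assms card_full_words_Suc in auto)

text \<open>If \<open>w\<close> maps onto \<open>[0, t)\<close> and \<open>w @ [d]\<close> is admissible but not full, then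
  \<open>d < \<beta> t < d + 1\<close>, so that \<open>d\<close> is determined by \<open>w\<close>.\<close>

lemma non_full_extension_unique:
  assumes \<beta>: "\<beta> > 1"
    and d: "w @ [d] \<in> beta_words \<beta> n - full_words \<beta> n"
    and e: "w @ [e] \<in> beta_words \<beta> n - full_words \<beta> n"
  shows "d = e"
proof -
  have "cylinder \<beta> w \<noteq> {}"
    using d by (auto simp: beta_words_iff_cylinder cylinder_snoc)
  then obtain a t where w: "affine_onto \<beta> w a t"
    using affine_onto_exists[OF \<beta>] by blast
  have "c = \<lfloor>\<beta> * t\<rfloor>" if c: "w @ [c] \<in> beta_words \<beta> n - full_words \<beta> n" for c
  proof -
    have ne: "cylinder \<beta> (w @ [c]) \<noteq> {}" and len: "length (w @ [c]) = n"
      using c by (auto simp: beta_words_iff_cylinder)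
    note bounds = snoc_digit_bounds[OF \<beta> w ne]
    have "min 1 (\<beta> * t - of_int c) \<noteq> 1"
      using full_iff_affine_onto_1[OF \<beta> affine_onto_snoc[OF \<beta> w bounds] len] c by blast
    then show ?thesis
      using bounds(2) by (intro floor_unique[symmetric]) (auto simp: min_def split: if_splits)
  qed
  then show ?thesis using d e by blast
qed

lemma card_beta_words_Suc:
  assumes "\<beta> > 1"
  shows "card (beta_words \<beta> (Suc n)) \<le> card (beta_words \<beta> n) + card (full_words \<beta> (Suc n))"
proof -
  let ?A = "beta_words \<beta> (Suc n) - full_words \<beta> (Suc n)"
  have split: "\<exists>v d. w = v @ [d] \<and> v \<in> beta_words \<beta> n" if "w \<in> ?A" for w
    using that
    by (cases w rule: rev_cases) (auto simp: beta_words_iff_cylinder cylinder_snoc)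
  have "card ?A \<le> card (beta_words \<beta> n)"
  proof (rule card_inj_on_le)
    show "inj_on butlast ?A"
    proof (rule inj_onI)
      fix u w assume uw: "u \<in> ?A" "w \<in> ?A" and eq: "butlast u = butlast w"
      obtain v d where u: "u = v @ [d]" using split[OF uw(1)] by blast
      obtain v' e where w: "w = v' @ [e]" using split[OF uw(2)] by blast
      have v': "v' = v" using eq u w by simp
      have "d = e"
        by (rule non_full_extension_unique[OF assms uw(1)[unfolded u] uw(2)[unfolded w v']])
      with u w v' show "u = w" by simp
    qed
    show "butlast ` ?A \<subseteq> beta_words \<beta> n"
      using split by fastforce
  qed (rule finite_beta_words[OF assms])
  moreover have "card ?A = card (beta_words \<beta> (Suc n)) - card (full_words \<beta> (Suc n))"
    by (rule card_Diff_subset[OF finite_full_words[OF assms]]) (auto simp: full_words_def)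
  ultimately show ?thesis by linarith
qed

lemma card_beta_words_le_sum:
  assumes "\<beta> > 1"
  shows "card (beta_words \<beta> n) \<le> (\<Sum>k\<le>n. card (full_words \<beta> k))"
proof (induction n)
  case 0
  have "w \<in> full_words \<beta> 0" if "w \<in> beta_words \<beta> 0" for w
    using that full_iff_affine_onto_1[OF assms affine_onto_Nil]
    by (auto simp: beta_words_iff_cylinder)
  then have "card (beta_words \<beta> 0) \<le> card (full_words \<beta> 0)"
    by (intro card_mono finite_full_words[OF assms]) blast
  then show ?case by simp
next
  case (Suc n)
  then show ?case using card_beta_words_Suc[OF assms, of n] by simp
qed

section \<open>Comparing full words with all words\<close>

theorem proposition3p1:
  fixes \<beta> l :: real and n :: nat
  assumes "\<beta> > 1"
    and "0 < l" and "l < 1"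
    and "l - l * ln l < (\<beta> - 1)^2 / \<beta>^3"
    and "l < 1 / \<beta>"
    and "n \<ge> 1"
    and "real n \<ge> - log \<beta> l"
  shows "real (card (full_words \<beta> n)) \<ge> l * real (card (beta_words \<beta> n))"
proof (rule ccontr)
  define F where "F k = real (card (full_words \<beta> k))" for k
  define N where "N = real (card (beta_words \<beta> n))"
  assume "\<not> real (card (full_words \<beta> n)) \<ge> l * real (card (beta_words \<beta> n))"
  then have few: "F n < l * N" by (simp add: F_def N_def)
  have N: "\<beta> ^ n \<le> N" using card_beta_words_ge[OF assms(1)] by (simp add: N_def)
  moreover have "0 < \<beta> ^ n" using assms(1) by simp
  ultimately have N0: "0 < N" by linarith
  have log0: "log \<beta> l < 0" using assms(1-3) by simp

  \<comment> \<open>The last exponent with \<open>\<beta>\<^sup>m \<le> l \<beta>\<^sup>n\<close>: beyond it the bound \<open>F k \<le> \<beta>\<^sup>k\<close> is of no use.\<close>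
  define m where "m = nat \<lfloor>real n + log \<beta> l\<rfloor>"
  have m: "real m \<le> real n + log \<beta> l" "real n + log \<beta> l < real m + 1"
    using assms(7) of_nat_nat[of "\<lfloor>real n + log \<beta> l\<rfloor>"] unfolding m_def by linarith+
  then have mn: "m \<le> n" using log0 by linarith
  have "\<beta> ^ m = \<beta> powr real m" using assms(1) by (simp add: powr_realpow)
  also have "\<dots> \<le> \<beta> powr (real n + log \<beta> l)" using m(1) assms(1) by simp
  also have "\<dots> = \<beta> ^ n * l" using assms(1,2) by (simp add: powr_add powr_realpow)
  also have "\<dots> \<le> N * l" using N assms(2) by simp
  finally have power_m: "\<beta> ^ m \<le> l * N" by (simp add: mult.commute)

  define q where "q = \<beta> / (\<beta> - 1)"
  have q: "q > 0" using assms(1) by (simp add: q_def)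
  have "(\<Sum>k\<le>m. F k) \<le> (\<Sum>k\<le>m. \<beta> ^ k)"
    unfolding F_def by (intro sum_mono card_full_words_le_power assms(1))
  also have "\<dots> = (\<beta> ^ Suc m - 1) / (\<beta> - 1)"
    using geometric_sum[of \<beta> "Suc m"] assms(1) by (simp add: lessThan_Suc_atMost)
  also have "\<dots> \<le> \<beta> ^ Suc m / (\<beta> - 1)"
    using assms(1) by (simp add: divide_right_mono)
  also have "\<dots> = q * \<beta> ^ m" by (simp add: q_def)
  also have "\<dots> \<le> q * (l * N)" using q power_m by simp
  finally have early: "(\<Sum>k\<le>m. F k) \<le> q * (l * N)" .

  have "(\<Sum>k\<in>{m<..n}. F k) \<le> (\<Sum>k\<in>{m<..n}. l * N)"
  proof (rule sum_mono)
    fix k assume "k \<in> {m<..n}"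
    then have "F k \<le> F n" using card_full_words_mono[OF assms(1), of k n] by (simp add: F_def)
    then show "F k \<le> l * N" using few by linarith
  qed
  also have "\<dots> = (real n - real m) * (l * N)" using mn by (simp add: of_nat_diff)
  also have "\<dots> \<le> (1 - q * ln l) * (l * N)"
  proof (rule mult_right_mono)
    have "ln (1 / \<beta>) \<le> 1 / \<beta> - 1" using assms(1) by (intro ln_le_minus_one) simp
    then have "1 - 1 / \<beta> \<le> ln \<beta>" using assms(1) by (simp add: ln_div)
    moreover have "1 / q = 1 - 1 / \<beta>" using assms(1) by (simp add: q_def field_simps)
    ultimately have "1 / q \<le> ln \<beta>" by simp
    then have "1 / ln \<beta> \<le> q"
      using q assms(1) by (simp add: field_simps)
    then have "- ln l * (1 / ln \<beta>) \<le> - ln l * q"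
      using assms(2,3) by (intro mult_left_mono) auto
    then have "- log \<beta> l \<le> - q * ln l" by (simp add: log_def mult.commute)
    then show "real n - real m \<le> 1 - q * ln l" using m(2) by simp
    show "0 \<le> l * N" using assms(2) N0 by simp
  qed
  finally have late: "(\<Sum>k\<in>{m<..n}. F k) \<le> (1 - q * ln l) * (l * N)" .

  have "N \<le> (\<Sum>k\<le>n. F k)"
    using card_beta_words_le_sum[OF assms(1), of n] unfolding N_def F_def
    by (metis of_nat_le_iff of_nat_sum)
  also have "\<dots> = (\<Sum>k\<le>m. F k) + (\<Sum>k\<in>{m<..n}. F k)"
  proof -
    have "{..n} = {..m} \<union> {m<..n}" using mn by auto
    then show ?thesis by (simp only:) (rule sum.union_disjoint; auto)
  qed
  also have "\<dots> \<le> q * (l * N) + (1 - q * ln l) * (l * N)" using early late by (rule add_mono)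
  also have "\<dots> = (q * (l - l * ln l) + l) * N" by (simp add: algebra_simps)
  also have "\<dots> < (q * ((\<beta> - 1)^2 / \<beta>^3) + 1 / \<beta>) * N"
    using q assms(4,5) N0 by (intro mult_strict_right_mono add_strict_mono mult_strict_left_mono)
  also have "\<dots> = (1 - ((\<beta> - 1) / \<beta>)^2) * N"
  proof -
    have "q * ((\<beta> - 1)^2 / \<beta>^3) = (\<beta> - 1) / \<beta>^2"
      using assms(1) by (simp add: q_def power2_eq_square power3_eq_cube)
    also have "\<dots> + 1 / \<beta> = 1 - ((\<beta> - 1) / \<beta>)^2"
      using assms(1) by (simp add: field_simps power2_eq_square)
    finally show ?thesis by simp
  qed
  also have "\<dots> \<le> N" using N0 by (simp add: mult_le_cancel_right1)
  finally show False by simp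
qed

end
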